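(* Let $G$ be a finite group that is neither trivial nor of prime order. Then $\mathcal P(G)$ is connected if and only if $G$ does not have a proper subgroup $H$ with $\pi(H)=\pi(G)$. In this case, $\mathrm{diam}(\mathcal P(G)) \in \{1,2,3\}$.
   Context: For a finite group $G$ that is neither trivial nor of prime order, the coprime graph of subgroups $\mathcal P(G)$ is the simple graph whose vertices are the proper subgroups of $G$ (here "proper" means different from $G$ and from the trivial subgroup), two distinct vertices $H,K$ being adjacent if and only if $|H|$ and $|K|$ are coprime. For a finite group $G$, $\pi(G)$ denotes the set of prime divisors of $|G|$. The diameter of a connected graph is the maximum of the lengths of shortest paths between pairs of vertices.
   Formalization: The formal theorem also assumes that G is not cyclic of order p² (p prime); for those groups the statement fails, since the graph is a single vertex H, connected with diameter 0, although π(H) = π(G). *)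

theory Defs
  imports
    "HOL-Algebra.Elementary_Groups"
    "HOL-Algebra.Sylow"
    "HOL-Computational_Algebra.Primes"
    "Graph_Theory.Digraph_Component"
    "Graph_Theory.Pair_Digraph"
    "Graph_Theory.Shortest_Path"
begin

definition proper_subgroup :: "'a set \<Rightarrow> ('a, 'b) monoid_scheme \<Rightarrow> bool" where
  "proper_subgroup H G \<longleftrightarrow> subgroup H G \<and> H \<noteq> carrier G \<and> H \<noteq> {\<one>\<^bsub>G\<^esub>}"

text \<open>The set \<open>\<pi>(H)\<close>, for a finite group given by its underlying set \<open>H\<close>.\<close>

definition prime_divisors :: "'a set \<Rightarrow> nat set" where
  "prime_divisors H = {p. prime p \<and> p dvd card H}"

text \<open>As usual in \<^theory>\<open>Graph_Theory.Pair_Digraph\<close>, an undirected simple graph is a symmetric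
  loop-free digraph whose arcs are pairs of vertices.\<close>

definition coprime_graph :: "('a, 'b) monoid_scheme \<Rightarrow> 'a set pair_pre_digraph" where
  "coprime_graph G =
    \<lparr> pverts = {H. proper_subgroup H G},
      parcs = {(H, K). proper_subgroup H G \<and> proper_subgroup K G \<and> H \<noteq> K \<and>
                       coprime (card H) (card K)} \<rparr>"

lemma pair_graph_coprime_graph:
  assumes "finite (carrier G)"
  shows "pair_graph (coprime_graph G)"
proof -
  have fin: "finite {H. proper_subgroup H G}"
    by (rule finite_subset[of _ "Pow (carrier G)"])
       (use assms in \<open>auto simp: proper_subgroup_def dest: subgroup.subset\<close>)
  have "finite {(H, K). proper_subgroup H G \<and> proper_subgroup K G \<and> H \<noteq> K \<and>
                       coprime (card H) (card K)}"
    by (rule finite_subset[OF _ finite_cartesian_product[OF fin fin]]) auto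
  then show ?thesis
    using fin
    by unfold_locales
      (auto simp: coprime_graph_def symmetric_def sym_def coprime_commute)
qed

text \<open>With unit weights, \<open>wf_digraph.\<mu>\<close> is the usual distance (the length of a shortest walk). For a
  finite connected graph the supremum below is a maximum.\<close>

definition diameter :: "('v, 'e) pre_digraph \<Rightarrow> ereal" where
  "diameter \<Gamma> = (SUP u \<in> verts \<Gamma>. SUP v \<in> verts \<Gamma>. wf_digraph.\<mu> \<Gamma> (\<lambda>_. 1) u v)"

end

theory Submission
  imports Defs "HOL-Algebra.Multiplicative_Group"
begin

text \<open>A proper subgroup \<open>H\<close> with \<open>\<pi>(H) = \<pi>(G)\<close> is an isolated vertex, so it can occur in a connected
  graph only as the sole vertex, which forces \<open>G\<close> to be cyclic of order \<open>p\<^sup>2\<close>. If there is no such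
  \<open>H\<close>, then every vertex \<open>H\<close> is adjacent to all subgroups of order \<open>p\<close>, for some \<open>p \<in> \<pi>(G) - \<pi>(H)\<close>.
  Given a second vertex \<open>K\<close> with such a prime \<open>q\<close>, either \<open>p = q\<close> and \<open>H\<close>, \<open>K\<close> have a common neighbour,
  or subgroups of orders \<open>p\<close> and \<open>q\<close> are adjacent to each other and give a walk of length 3.\<close>

section \<open>Cyclic groups and groups with exactly one proper subgroup\<close>

lemma (in group) cyclic_iso_integer_mod_group:
  assumes fin: "finite (carrier G)" and x: "x \<in> carrier G" and gen: "generate G {x} = carrier G"
  shows "G \<cong> integer_mod_group (order G)"
proof -
  let ?Z = "integer_mod_group (order G)" and ?h = "\<lambda>k::int. x [^] k"
  have n: "order G > 0"
    using fin order_gt_0_iff_finite by blast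
  have pow_n: "x [^] (int (order G)) = \<one>"
    using pow_order_eq_1[OF x] by (simp add: int_pow_int)
  \<comment> \<open>Exponents matter only modulo the group order, so the exponent map turns addition
    in \<open>?Z\<close> into multiplication.\<close>
  have pow_mod: "x [^] (k mod int (order G)) = x [^] k" for k :: int
  proof -
    have "x [^] k = x [^] (int (order G) * (k div int (order G)) + k mod int (order G))"
      by simp
    also have "\<dots> = x [^] (k mod int (order G))"
      using x pow_n by (simp only: int_pow_mult int_pow_pow[symmetric] int_pow_one) simp
    finally show ?thesis by simp
  qed
  have car: "carrier ?Z = {0..<int (order G)}"
    using n by (simp add: carrier_integer_mod_group)
  have hom: "?h \<in> hom ?Z G"
    using x by (auto simp: hom_def pow_mod int_pow_mult)
  have surj: "?h ` carrier ?Z = carrier G"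
  proof
    show "?h ` carrier ?Z \<subseteq> carrier G"
      using x by auto
    show "carrier G \<subseteq> ?h ` carrier ?Z"
    proof
      fix y assume "y \<in> carrier G"
      then obtain k :: int where "y = x [^] k"
        using gen x by (auto simp: generate_pow)
      then have "y = ?h (k mod int (order G))"
        by (simp add: pow_mod)
      moreover have "k mod int (order G) \<in> carrier ?Z"
        using n by (simp add: car)
      ultimately show "y \<in> ?h ` carrier ?Z"
        by blast
    qed
  qed
  \<comment> \<open>A surjection between finite sets of equal size, here \<open>order G\<close>, is
    injective.\<close>
  then have "inj_on ?h (carrier ?Z)"
    by (intro eq_card_imp_inj_on) (simp_all only: car, simp_all add: order_def)
  with hom surj have "?h \<in> iso ?Z G"
    by (simp add: iso_def bij_betw_def)
  then have "?Z \<cong> G"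
    by (auto simp: is_iso_def)
  then show ?thesis
    by (rule group.iso_sym[OF group_integer_mod_group])
qed

lemma proper_subgroup_card:
  assumes "group G" "finite (carrier G)" "proper_subgroup H G"
  shows "card H dvd order G" "card H \<noteq> 1" "card H \<noteq> order G"
proof -
  interpret group G by fact
  have H: "subgroup H G" "H \<noteq> carrier G" "H \<noteq> {\<one>\<^bsub>G\<^esub>}"
    using assms by (auto simp: proper_subgroup_def)
  show "card H dvd order G"
    using lagrange[OF H(1)] by (metis dvd_triv_right)
  show "card H \<noteq> 1"
    using H subgroup.one_closed[OF H(1)] by (auto simp: card_1_singleton_iff)
  show "card H \<noteq> order G"
    using card_subset_eq[OF assms(2) subgroup.subset[OF H(1)]] H(2) by (auto simp: order_def)
qed

text \<open>The exponent in \<open>sylow_thm\<close> may be any with \<open>p ^ a\<close> dividing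
  the order, so \<open>a = 1\<close> gives Cauchy's theorem. The last two assumptions keep the
  subgroup from being all of \<open>G\<close> or trivial.\<close>

lemma proper_subgroup_prime_power:
  assumes "group G" "finite (carrier G)"
    and p: "prime p" "p ^ a dvd order G" "order G \<noteq> p ^ a" "a \<noteq> 0"
  obtains P where "proper_subgroup P G" "card P = p ^ a"
proof -
  obtain m where "order G = p ^ a * m"
    using p(2) by blast
  then obtain P where P: "subgroup P G" "card P = p ^ a"
    using sylow_thm[OF p(1) assms(1) _ assms(2)] by blast
  have "1 < p ^ a"
    using p(1,4) prime_gt_1_nat by (intro one_less_power) auto
  then have "card P \<noteq> 1" "card P \<noteq> card (carrier G)"
    using P(2) p(3) unfolding order_def by linarith+
  then have "proper_subgroup P G"
    using P(1) by (auto simp: proper_subgroup_def)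
  with P(2) that show thesis by blast
qed

text \<open>Any element outside \<open>H\<close> generates \<open>G\<close>, so \<open>G\<close> is
  cyclic. Cauchy's theorem leaves \<open>card H\<close> as the only prime divisor of the order, and
  a subgroup of order \<open>p ^ 2\<close> would be a second proper subgroup unless it is all of
  \<open>G\<close>.\<close>

lemma unique_proper_subgroup_imp_iso:
  assumes "group G" "finite (carrier G)" and H: "{K. proper_subgroup K G} = {H}"
  shows "\<exists>p. prime p \<and> G \<cong> integer_mod_group (p ^ 2)"
proof -
  interpret group G by fact
  have HG: "proper_subgroup H G"
    using H by auto
  have uniq: "K = H" if "proper_subgroup K G" for K
    using H that by auto
  note cH = proper_subgroup_card[OF assms(1,2) HG]
  have n: "order G > 0"
    using assms(2) order_gt_0_iff_finite by blast
  have sub: "subgroup H G" "H \<subset> carrier G"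
    using HG subgroup.subset by (auto simp: proper_subgroup_def)
  then obtain x where x: "x \<in> carrier G" "x \<notin> H"
    by blast
  have gen: "generate G {x} = carrier G"
  proof (rule ccontr)
    assume ne: "generate G {x} \<noteq> carrier G"
    have "x \<in> generate G {x}"
      by (simp add: generate.incl)
    moreover have "x \<noteq> \<one>\<^bsub>G\<^esub>"
      using x sub subgroup.one_closed by blast
    ultimately have "proper_subgroup (generate G {x}) G"
      using ne x generate_is_subgroup[of "{x}"] by (auto simp: proper_subgroup_def)
    then show False
      using uniq x \<open>x \<in> generate G {x}\<close> by blast
  qed
  have prime_sub: "q = card H" if "prime q" "q dvd order G" "order G \<noteq> q" for q
    using proper_subgroup_prime_power[of G q 1] assms that uniq by (metis power_one_right one_neq_zero)
  obtain p where p: "prime p" "p dvd card H"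
    using prime_factor_nat cH(2) by blast
  \<comment> \<open>Strictness is what rules out the exception \<open>order G = p\<close> in
    \<open>prime_sub\<close>.\<close>
  have "p < order G"
    using p cH n dvd_imp_le by (metis dvd_trans le_neq_implies_less dvd_antisym)
  then have pH: "card H = p"
    using prime_sub[of p] p cH by (metis dvd_trans less_irrefl_nat)
  \<comment> \<open>The index \<open>m\<close> of \<open>H\<close> is not 1, and a prime factor of
    it must again be \<open>p\<close>, which yields a second factor \<open>p\<close> of the
    order.\<close>
  obtain m where m: "order G = p * m"
    using cH(1) pH by blast
  have "m \<noteq> 1"
    using m cH(3) pH by auto
  then obtain q where q: "prime q" "q dvd m"
    using prime_factor_nat by blast
  have "q < order G"
    using q m n p(1) dvd_imp_le[of q m] prime_gt_1_nat[of p] by (cases "m = 0") (auto intro: le_less_trans)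
  then have "q = p"
    using prime_sub[of q] q m pH by (metis dvd_mult less_irrefl_nat)
  then have p2: "p ^ 2 dvd order G"
    using q m by (simp add: power2_eq_square mult_dvd_mono)
  have "order G = p ^ 2"
  proof (rule ccontr)
    assume "order G \<noteq> p ^ 2"
    then obtain P where "proper_subgroup P G" "card P = p ^ 2"
      using proper_subgroup_prime_power[OF assms(1,2) p(1) p2] by auto
    then have "p ^ 2 = p"
      using uniq pH by simp
    then show False
      using p(1) prime_gt_1_nat by (simp add: power2_eq_square)
  qed
  then show ?thesis
    using cyclic_iso_integer_mod_group[OF assms(2) x(1) gen] p(1) by auto
qed

section \<open>Distances, diameter and isolated vertices in digraphs\<close>

lemma SUP_mem_finite:
  fixes f :: "'a \<Rightarrow> 'b::complete_linorder"
  assumes "A \<noteq> {}" "finite S" "f ` A \<subseteq> S"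
  shows "(SUP x\<in>A. f x) \<in> S"
proof -
  have "finite (f ` A)"
    using assms finite_subset by blast
  then show ?thesis
    using assms Max_in[of "f ` A"] Max_Sup[of "f ` A"] by auto
qed

text \<open>The infimum defining \<open>\<mu>\<close> is attained by a walk of least length. If that
  walk is empty, its endpoints coincide.\<close>

lemma (in wf_digraph) unit_distance:
  assumes "awalk u p v"
  obtains k where "\<mu> (\<lambda>_. 1) u v = ereal (real k)" "k \<le> length p" "k = 0 \<Longrightarrow> u = v"
proof -
  have cost: "awalk_cost (\<lambda>_. 1) q = real (length q)" for q :: "'b list"
    by (induction q) auto
  obtain q where q: "awalk u q v" "\<And>r. awalk u r v \<Longrightarrow> length q \<le> length r"
    using assms exists_least_iff[of "\<lambda>k. \<exists>q. awalk u q v \<and> length q = k"]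
    by (metis linorder_not_le)
  have "\<mu> (\<lambda>_. 1) u v = ereal (real (length q))"
    unfolding \<mu>_def cost using q by (intro INF_eqI) auto
  then show thesis
    using that[of "length q"] q assms by (auto simp: awalk_Nil_iff)
qed

text \<open>All distances lie in a finite set of values, so both suprema are attained and stay in
  it. The distinct vertices \<open>a\<close> and \<open>b\<close> have positive distance, which
  excludes 0.\<close>

lemma (in wf_digraph) diameter_mem:
  assumes ne: "a \<in> verts G" "b \<in> verts G" "a \<noteq> b"
    and walks: "\<And>u v. u \<in> verts G \<Longrightarrow> v \<in> verts G \<Longrightarrow> \<exists>p. awalk u p v \<and> length p \<le> d"
  shows "diameter G \<in> (\<lambda>k. ereal (real k)) ` {1..d}"
proof -
  let ?S = "(\<lambda>k. ereal (real k)) ` {0..d}"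
  have dist: "\<exists>k\<le>d. \<mu> (\<lambda>_. 1) u v = ereal (real k) \<and> (k = 0 \<longrightarrow> u = v)"
    if "u \<in> verts G" "v \<in> verts G" for u v
  proof -
    obtain p where "awalk u p v" "length p \<le> d"
      using walks \<open>u \<in> verts G\<close> \<open>v \<in> verts G\<close> by blast
    then show ?thesis
      by (metis unit_distance order_trans)
  qed
  have "(SUP v \<in> verts G. \<mu> (\<lambda>_. 1) u v) \<in> ?S" if "u \<in> verts G" for u
    using ne dist[OF that] by (intro SUP_mem_finite) (auto simp: image_iff, meson atLeastAtMost_iff zero_le)
  then have "diameter G \<in> ?S"
    unfolding diameter_def using ne by (intro SUP_mem_finite) auto
  then obtain k where k: "k \<le> d" "diameter G = ereal (real k)"
    by auto
  obtain l where l: "\<mu> (\<lambda>_. 1) a b = ereal (real l)" "l \<noteq> 0"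
    using dist[OF ne(1,2)] ne(3) by blast
  have "\<mu> (\<lambda>_. 1) a b \<le> diameter G"
    unfolding diameter_def using ne by (meson SUP_upper2 SUP_upper)
  then show ?thesis
    using k l by auto
qed

text \<open>Connectedness refers to the symmetric closure of the arcs, hence the two isolation
  hypotheses: together they deny a first step to any path leaving \<open>u\<close>.\<close>

lemma connected_isolated_vertex:
  assumes "Digraph_Component.connected G" "u \<in> verts G"
    and isolated: "\<And>v. (u, v) \<notin> arcs_ends G" "\<And>v. (v, u) \<notin> arcs_ends G"
  shows "verts G = {u}"
proof -
  have "v = u" if "v \<in> verts G" for v
  proof -
    have "(u, v) \<in> rtrancl_on (verts G) ((arcs_ends G)\<^sup>s)"
      using assms that by (simp add: connected_conv)
    then show ?thesis
      using isolated by (cases rule: converse_rtrancl_on_cases) (auto simp: symcl_def)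
  qed
  then show ?thesis
    using assms(2) by blast
qed

section \<open>Arcs and walks in the coprime graph\<close>

lemma coprime_graph_arc_iff:
  "(H, K) \<in> parcs (coprime_graph G) \<longleftrightarrow>
    proper_subgroup H G \<and> proper_subgroup K G \<and> H \<noteq> K \<and> coprime (card H) (card K)"
  by (simp add: coprime_graph_def)

text \<open>A proper \<open>K\<close> has order different from 1, hence a prime divisor; it divides
  \<open>order G\<close> by Lagrange and therefore also \<open>card H\<close>.\<close>

lemma coprime_graph_isolated:
  assumes "group G" "finite (carrier G)" and "prime_divisors H = prime_divisors (carrier G)"
  shows "(H, K) \<notin> parcs (coprime_graph G)" "(K, H) \<notin> parcs (coprime_graph G)"
proof -
  have "\<not> coprime (card H) (card K)" if K: "proper_subgroup K G"
  proof -
    obtain p where p: "prime p" "p dvd card K"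
      using prime_factor_nat proper_subgroup_card(2)[OF assms(1,2) K] by blast
    then have "p dvd order G"
      using proper_subgroup_card(1)[OF assms(1,2) K] dvd_trans by blast
    then have "p dvd card H"
      using assms(3) p by (auto simp: prime_divisors_def order_def)
    then show ?thesis
      using p by (metis coprime_common_divisor_nat not_prime_1)
  qed
  then show "(H, K) \<notin> parcs (coprime_graph G)" "(K, H) \<notin> parcs (coprime_graph G)"
    by (auto simp: coprime_graph_arc_iff coprime_commute)
qed

text \<open>By Lagrange, primes of \<open>card H\<close> divide \<open>order G\<close>, so the two
  sets can differ only by a prime missing from \<open>card H\<close>. Adjacency is stated for every
  subgroup of order \<open>p\<close> so that a single \<open>P\<close> can be a neighbour of two
  given vertices sharing this prime.\<close>

lemma coprime_graph_prime_neighbor: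
  assumes "group G" "finite (carrier G)" "\<not> prime (order G)"
    and H: "proper_subgroup H G" "prime_divisors H \<noteq> prime_divisors (carrier G)"
  obtains p where "prime p"
    "\<And>P. proper_subgroup P G \<Longrightarrow> card P = p \<Longrightarrow> (H, P) \<in> parcs (coprime_graph G)"
    "\<exists>P. proper_subgroup P G \<and> card P = p"
proof -
  note cH = proper_subgroup_card[OF assms(1,2) H(1)]
  obtain p where p: "prime p" "p dvd order G" "\<not> p dvd card H"
    using H(2) dvd_trans[OF _ cH(1)] by (auto simp: prime_divisors_def order_def)
  have "\<exists>P. proper_subgroup P G \<and> card P = p"
    using proper_subgroup_prime_power[OF assms(1,2) p(1), of 1] p assms(3) by (metis power_one_right one_neq_zero)
  moreover have "(H, P) \<in> parcs (coprime_graph G)" if "proper_subgroup P G" "card P = p" for P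
    using that p H(1) prime_imp_coprime[of p "card H"]
    by (auto simp: coprime_graph_arc_iff coprime_commute)
  ultimately show thesis
    using that p(1) by blast
qed

lemma coprime_graph_short_walk:
  assumes "group G" "finite (carrier G)" "\<not> prime (order G)"
    and no: "\<not> (\<exists>H. proper_subgroup H G \<and> prime_divisors H = prime_divisors (carrier G))"
    and HK: "proper_subgroup H G" "proper_subgroup K G"
  shows "\<exists>w. pre_digraph.awalk (with_proj (coprime_graph G)) H w K \<and> length w \<le> 3"
proof -
  interpret pair_graph "coprime_graph G"
    using pair_graph_coprime_graph[OF assms(2)] .
  have verts: "L \<in> pverts (coprime_graph G) \<longleftrightarrow> proper_subgroup L G" for L
    by (simp add: coprime_graph_def)
  have sym: "(L, M) \<in> parcs (coprime_graph G)" if "(M, L) \<in> parcs (coprime_graph G)" for L M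
    using that by (auto simp: coprime_graph_arc_iff coprime_commute)
  obtain p where p: "prime p"
    "\<And>P. proper_subgroup P G \<Longrightarrow> card P = p \<Longrightarrow> (H, P) \<in> parcs (coprime_graph G)"
    "\<exists>P. proper_subgroup P G \<and> card P = p"
    using coprime_graph_prime_neighbor[OF assms(1-3) HK(1)] no HK by metis
  obtain q where q: "prime q"
    "\<And>P. proper_subgroup P G \<Longrightarrow> card P = q \<Longrightarrow> (K, P) \<in> parcs (coprime_graph G)"
    "\<exists>P. proper_subgroup P G \<and> card P = q"
    using coprime_graph_prime_neighbor[OF assms(1-3) HK(2)] no HK by metis
  obtain P where P: "proper_subgroup P G" "card P = p"
    using p(3) by blast
  obtain Q where Q: "proper_subgroup Q G" "card Q = q"
    using q(3) by blast
  show ?thesis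
  proof (cases "p = q")
    case True
    \<comment> \<open>As \<open>card P = q\<close> too, \<open>q(2)\<close> applies to
      \<open>P\<close>. A walk may repeat vertices, so \<open>H = K\<close> is covered.\<close>
    have "awalk H [(H, P), (P, K)] K"
      using p(2)[OF P] q(2)[of P] P True sym HK by (simp add: awalk_def verts)
    then show ?thesis
      by (intro exI[of _ "[(H, P), (P, K)]"]) simp
  next
    case False
    then have "(P, Q) \<in> parcs (coprime_graph G)"
      using P Q p(1) q(1) primes_coprime by (auto simp: coprime_graph_arc_iff)
    then have "awalk H [(H, P), (P, Q), (Q, K)] K"
      using p(2)[OF P] q(2)[OF Q] sym HK by (simp add: awalk_def verts)
    then show ?thesis
      by (intro exI[of _ "[(H, P), (P, Q), (Q, K)]"]) simp
  qed
qed

text \<open>For \<open>G\<close> cyclic of order \<open>p ^ 2\<close> the graph is a single vertex: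
  it is connected with diameter 0, although the subgroup of order \<open>p\<close> has the same
  prime divisors as \<open>G\<close>. The hypothesis \<open>not_one_vertex\<close> excludes this
  case.\<close>

theorem theorem2p5:
  fixes G :: "('a, 'b) monoid_scheme"
  assumes "group G" and "finite (carrier G)"
    and "order G \<noteq> 1" and "\<not> prime (order G)"
    and not_one_vertex: "\<not> (\<exists>p::nat. prime p \<and> G \<cong> integer_mod_group (p ^ 2))"
  shows "(Digraph_Component.connected (with_proj (coprime_graph G)) \<longleftrightarrow>
            \<not> (\<exists>H. proper_subgroup H G \<and> prime_divisors H = prime_divisors (carrier G))) \<and>
         (Digraph_Component.connected (with_proj (coprime_graph G)) \<longrightarrow>
            diameter (with_proj (coprime_graph G)) \<in> {1, 2, 3})"
proof -
  let ?C = "coprime_graph G"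
  let ?no = "\<not> (\<exists>H. proper_subgroup H G \<and> prime_divisors H = prime_divisors (carrier G))"
  interpret pair_graph ?C
    using pair_graph_coprime_graph[OF assms(2)] .
  have verts: "pverts ?C = {H. proper_subgroup H G}"
    by (simp add: coprime_graph_def)
  have conn_no: ?no if "Digraph_Component.connected (with_proj ?C)"
  proof
    assume "\<exists>H. proper_subgroup H G \<and> prime_divisors H = prime_divisors (carrier G)"
    then obtain H where "proper_subgroup H G" "prime_divisors H = prime_divisors (carrier G)"
      by blast
    then have "pverts ?C = {H}"
      using connected_isolated_vertex[OF that, of H] coprime_graph_isolated[OF assms(1,2), of H]
      by (simp add: verts)
    then show False
      using unique_proper_subgroup_imp_iso[OF assms(1,2)] not_one_vertex verts by simp
  qed
  \<comment> \<open>This supplies a vertex, since connectedness requires a nonempty vertex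
    set.\<close>
  obtain p where p: "prime p" "p dvd order G"
    using prime_factor_nat assms(3) by blast
  then obtain H where H: "proper_subgroup H G"
    using proper_subgroup_prime_power[OF assms(1,2) p(1), of 1] assms(4)
    by (metis power_one_right one_neq_zero)
  have walks: "\<exists>w. awalk u w v \<and> length w \<le> 3" if ?no "u \<in> pverts ?C" "v \<in> pverts ?C" for u v
    using coprime_graph_short_walk[OF assms(1,2,4)] that by (simp add: verts)
  have no_conn: "Digraph_Component.connected (with_proj ?C)" if ?no
  proof (rule connectedI)
    show "pverts ?C \<noteq> {}"
      using H verts by auto
    \<comment> \<open>Connectedness means reachability in the symmetrised graph, to which walks of
      the graph itself carry over.\<close>
    show "u \<rightarrow>\<^sup>*\<^bsub>with_proj (mk_symmetric (with_proj ?C))\<^esub> v"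
      if "u \<in> pverts ?C" "v \<in> pverts ?C" for u v
      using walks[OF \<open>?no\<close> that] reachable_awalk reachable_mk_symmetricI by blast
  qed
  have "diameter (with_proj ?C) \<in> {1, 2, 3}" if ?no
  proof -
    have "prime_divisors H \<noteq> prime_divisors (carrier G)"
      using that H by blast
    \<comment> \<open>A neighbour of \<open>H\<close> provides the pair of distinct vertices that
      makes the diameter positive.\<close>
    from coprime_graph_prime_neighbor[OF assms(1,2,4) H this]
    obtain P where "(H, P) \<in> parcs ?C"
      by blast
    then have HP: "H \<in> pverts ?C" "P \<in> pverts ?C" "H \<noteq> P"
      by (auto simp: verts coprime_graph_arc_iff)
    have "diameter (with_proj ?C) \<in> (\<lambda>k. ereal (real k)) ` {1..3}"
      by (rule diameter_mem[OF HP walks[OF that]])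
    moreover have "{1..3} = {1, 2, 3::nat}"
      by auto
    ultimately show ?thesis
      by (auto simp: one_ereal_def)
  qed
  with conn_no no_conn show ?thesis
    by blast
qed

end
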